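(* Let $0\le r\le n$ be integers, let $[p,q]$ be a compact real interval, let $x_0,x_1,\dots,x_{r-1}\in[p,q]$ be $r$ numbers, let $x_r,x_{r+1},\dots,x_n\in[p,q]$ be $n-r+1$ distinct numbers, let $x\in[p,q]$, and let $f\in C^{n+1}[p,q]$. Let $D_{r,r+1,\dots,n}[x]$ and $d_{r,r+1,\dots,n}[x]$ be the Neville and Aitken iterates of the divided differences $f[x_j,x_0,\dots,x_{r-1}]$ ($j=r,\dots,n$) defined in the context. Then there exists $\xi$ in the smallest closed interval containing $x,x_0,x_1,\dots,x_n$ such that $$f[x,x_0,x_1,\dots,x_{r-1}] = D_{r,r+1,\dots,n}[x]+\frac{f^{(n+1)}(\xi)}{(n+1)!}\prod_{i=r}^{n}(x-x_i)$$ and $$f[x,x_0,x_1,\dots,x_{r-1}] = d_{r,r+1,\dots,n}[x]+\frac{f^{(n+1)}(\xi)}{(n+1)!}\prod_{i=r}^{n}(x-x_i).$$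
   Context: Divided differences: $f[y_0,\dots,y_m]$ denotes the usual divided difference of order $m$ of $f$ at $y_0,\dots,y_m$, understood in the confluent (Hermite) sense when points coincide, i.e. the coefficient of $y^m$ in the polynomial of degree $\le m$ that interpolates $f$ at $y_0,\dots,y_m$ with multiplicity; in particular $f[y]=f(y)$ and $f[y,\dots,y]$ ($k+1$ times) $=f^{(k)}(y)/k!$. Neville iterates: for $j=r,\dots,n$ put $D_j[x]=f[x_j,x_0,x_1,\dots,x_{r-1}]$ (so $D_j[x]=f(x_j)$ if $r=0$). For $i=1,\dots,n-r$ and $j=r,\dots,n-i$ put $$D_{j,j+1,\dots,j+i}[x]=\frac{1}{x_{i+j}-x_j}\begin{vmatrix} D_{j,j+1,\dots,j+i-1}[x] & x_j-x\\ D_{j+1,j+2,\dots,j+i}[x] & x_{i+j}-x\end{vmatrix}.$$ Aitken iterates: for $j=r,\dots,n$ put $d_j[x]=f[x_j,x_0,x_1,\dots,x_{r-1}]$. For $i=r,\dots,n-1$ and $j=i+1,\dots,n$ put $$d_{r,r+1,\dots,i-1,i,j}[x]=\frac{1}{x_j-x_i}\begin{vmatrix} d_{r,r+1,\dots,i-1,i}[x] & x_i-x\\ d_{r,r+1,\dots,i-1,j}[x] & x_j-x\end{vmatrix},$$ where for $i=r$ the entries in the first column are $d_r[x]$ and $d_j[x]$. Vertical bars denote $2\times 2$ determinants. *)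

theory Defs
  imports "HOL-Analysis.Analysis" "HOL-Computational_Algebra.Polynomial"
begin

text \<open>Derivatives are taken relative to the domain \<open>S\<close>, so that they are one-sided at
  the endpoints of a compact interval.\<close>

primrec nderiv_on :: "real set \<Rightarrow> (real \<Rightarrow> real) \<Rightarrow> nat \<Rightarrow> real \<Rightarrow> real" where
  "nderiv_on S f 0 = f"
| "nderiv_on S f (Suc k) = (\<lambda>y. vector_derivative (nderiv_on S f k) (at y within S))"

definition Ck_on :: "nat \<Rightarrow> real set \<Rightarrow> (real \<Rightarrow> real) \<Rightarrow> bool" where
  "Ck_on k S f \<longleftrightarrow>
     (\<forall>i<k. nderiv_on S f i differentiable_on S) \<and> continuous_on S (nderiv_on S f k)"

text \<open>The nodes are a list with repetitions; a node occurring \<open>m\<close> times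
  prescribes the derivatives of orders \<open>0, \<dots>, m - 1\<close>.\<close>

definition hermite_interpolates ::
    "real set \<Rightarrow> (real \<Rightarrow> real) \<Rightarrow> real list \<Rightarrow> real poly \<Rightarrow> bool" where
  "hermite_interpolates S f ys P \<longleftrightarrow>
     degree P < length ys \<and>
     (\<forall>y\<in>set ys. \<forall>k<count_list ys y. poly ((pderiv ^^ k) P) y = nderiv_on S f k y)"

text \<open>Confluent divided difference of \<open>f\<close> at the nonempty node list \<open>ys\<close>.\<close>

definition divdiff :: "real set \<Rightarrow> (real \<Rightarrow> real) \<Rightarrow> real list \<Rightarrow> real" where
  "divdiff S f ys = coeff (THE P. hermite_interpolates S f ys P) (length ys - 1)"

text \<open>\<open>divdiff_at S f X r y\<close> is \<open>f[y, x\<^sub>0, \<dots>, x\<^bsub>r-1\<^esub>]\<close>, where \<open>x\<^sub>i = X i\<close>.\<close>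

definition divdiff_at ::
    "real set \<Rightarrow> (real \<Rightarrow> real) \<Rightarrow> (nat \<Rightarrow> real) \<Rightarrow> nat \<Rightarrow> real \<Rightarrow> real" where
  "divdiff_at S f X r y = divdiff S f (y # map X [0..<r])"

text \<open>\<open>neville S f X r x i j\<close> is \<open>D\<^bsub>j,j+1,\<dots>,j+i\<^esub>[x]\<close>.\<close>

primrec neville ::
    "real set \<Rightarrow> (real \<Rightarrow> real) \<Rightarrow> (nat \<Rightarrow> real) \<Rightarrow> nat \<Rightarrow> real \<Rightarrow> nat \<Rightarrow> nat \<Rightarrow> real" where
  "neville S f X r x 0 = (\<lambda>j. divdiff_at S f X r (X j))"
| "neville S f X r x (Suc i) = (\<lambda>j.
     1 / (X (Suc i + j) - X j) *
     det (vector [vector [neville S f X r x i j,       X j - x],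
                  vector [neville S f X r x i (j + 1), X (Suc i + j) - x]] :: real^2^2))"

text \<open>\<open>aitken S f X r x k j\<close> is the iterate with the \<open>k + 1\<close> indices
  \<open>r, r+1, \<dots>, r+k-1, j\<close>; thus \<open>d\<^bsub>r,\<dots>,i-1,i,j\<^esub>[x]\<close> is the case \<open>k = i - r + 1\<close>,
  and \<open>d\<^bsub>r,\<dots>,i-1,i\<^esub>[x]\<close> is \<open>aitken S f X r x (i - r) i\<close>.\<close>

primrec aitken ::
    "real set \<Rightarrow> (real \<Rightarrow> real) \<Rightarrow> (nat \<Rightarrow> real) \<Rightarrow> nat \<Rightarrow> real \<Rightarrow> nat \<Rightarrow> nat \<Rightarrow> real" where
  "aitken S f X r x 0 = (\<lambda>j. divdiff_at S f X r (X j))"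
| "aitken S f X r x (Suc k) = (\<lambda>j.
     1 / (X j - X (r + k)) *
     det (vector [vector [aitken S f X r x k (r + k), X (r + k) - x],
                  vector [aitken S f X r x k j,       X j - x]] :: real^2^2))"

end

theory Submission
  imports Defs
begin

text \<open>Let \<open>P\<close> be the Hermite interpolant of \<open>f\<close> at \<open>x, x\<^sub>0, \<dots>, x\<^sub>n\<close>, and let \<open>Q\<close> be the quotient of
  \<open>P\<close> by \<open>(t - x\<^sub>0) \<cdots> (t - x\<^bsub>r-1\<^esub>)\<close>. For \<open>y\<close> among \<open>x, x\<^sub>r, \<dots>, x\<^sub>n\<close>, the divided difference
  \<open>f[y, x\<^sub>0, \<dots>, x\<^bsub>r-1\<^esub>]\<close> involves only data shared by \<open>f\<close> and \<open>P\<close>, and it equals \<open>Q(y)\<close>.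
  Both the Neville and the Aitken iterate are the value at \<open>x\<close> of the polynomial \<open>L\<close> of degree at
  most \<open>n - r\<close> that agrees with \<open>Q\<close> at \<open>x\<^sub>r, \<dots>, x\<^sub>n\<close>, whence
  \<open>Q - L = c (t - x\<^sub>r) \<cdots> (t - x\<^sub>n)\<close> with \<open>c\<close> the coefficient of \<open>t\<^bsup>n+1\<^esup>\<close> in \<open>P\<close>. Finally
  \<open>f - P\<close> has \<open>n + 2\<close> zeros counted with multiplicity, so Rolle's theorem gives a zero \<open>\<xi>\<close> of
  \<open>f\<^bsup>(n+1)\<^esup> - (n+1)! c\<close>.\<close>

section \<open>Hermite interpolation\<close>

text \<open>In characteristic 0, differentiation lowers the order of a root by exactly one, so the
  induction passes from \<open>p\<close> to \<open>pderiv p\<close>.\<close>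

lemma linear_power_dvd_iff_higher_pderiv:
  fixes p :: "'a::field_char_0 poly"
  shows "[:- y, 1:] ^ m dvd p \<longleftrightarrow> (\<forall>k<m. poly ((pderiv ^^ k) p) y = 0)"
proof (induction m arbitrary: p)
  case (Suc m)
  have "[:- y, 1:] ^ Suc m dvd p \<longleftrightarrow> poly p y = 0 \<and> [:- y, 1:] ^ m dvd pderiv p"
  proof (cases "p \<noteq> 0 \<and> poly p y = 0")
    case False
    moreover have "poly p y = 0" if "[:- y, 1:] ^ Suc m dvd p"
      using that unfolding power_Suc poly_eq_0_iff_dvd by (rule dvd_mult_left)
    ultimately show ?thesis by auto
  next
    case True
    then have "pderiv p \<noteq> 0"
      using order_degree[of p y] by (auto simp: pderiv_eq_0_iff order_root)
    with True show ?thesis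
      by (simp add: order_divides order_pderiv del: power_Suc)
  qed
  also have "\<dots> \<longleftrightarrow> (\<forall>k<Suc m. poly ((pderiv ^^ k) p) y = 0)"
    unfolding Suc.IH by (simp add: All_less_Suc2 funpow_Suc_right del: funpow.simps(2))
  finally show ?case .
qed simp

section \<open>Node polynomials and divisibility by them\<close>

definition node_poly :: "real list \<Rightarrow> real poly" where
  "node_poly ys = (\<Prod>y\<leftarrow>ys. [:- y, 1:])"

lemma node_poly_Nil [simp]: "node_poly [] = 1"
  by (simp add: node_poly_def)

lemma node_poly_Cons: "node_poly (y # ys) = [:- y, 1:] * node_poly ys"
  by (simp add: node_poly_def)

lemma node_poly_append: "node_poly (xs @ ys) = node_poly xs * node_poly ys"
  by (simp add: node_poly_def)

lemma node_poly_nonzero [simp]: "node_poly ys \<noteq> 0"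
  by (induction ys) (simp_all add: node_poly_Cons del: mult_pCons_left)

lemma degree_node_poly [simp]: "degree (node_poly ys) = length ys"
  by (induction ys) (simp_all add: node_poly_Cons degree_mult_eq del: mult_pCons_left)

lemma coeff_node_poly_length [simp]: "coeff (node_poly ys) (length ys) = 1"
proof -
  have "lead_coeff (node_poly ys) = 1"
    by (induction ys) (simp_all only: node_poly_Cons lead_coeff_mult, simp_all)
  then show ?thesis by simp
qed

lemma poly_node_poly: "poly (node_poly ys) x = (\<Prod>y\<leftarrow>ys. x - y)"
  by (induction ys) (simp_all add: node_poly_Cons algebra_simps)

lemma order_linear: "order z [:- y, 1:] = (if y = z then 1 else (0::nat))" for y z :: real
  using order_power_n_n[of y 1] by (auto intro: order_0I)

lemma order_node_poly: "order z (node_poly ys) = count_list ys z"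
proof (induction ys)
  case (Cons y ys)
  have "node_poly (y # ys) \<noteq> 0" by (rule node_poly_nonzero)
  then show ?case
    unfolding node_poly_Cons by (subst order_mult) (auto simp: order_linear Cons.IH)
qed (simp add: order_0I)

text \<open>For the converse, one linear factor at a time is stripped off both sides. The case
  \<open>p = 0\<close> is set apart because \<open>order\<close> is informative only for nonzero
  polynomials.\<close>

lemma node_poly_dvd_iff_order:
  "node_poly ys dvd p \<longleftrightarrow> p = 0 \<or> (\<forall>z. count_list ys z \<le> order z p)"
proof
  assume "node_poly ys dvd p"
  then show "p = 0 \<or> (\<forall>z. count_list ys z \<le> order z p)"
    by (metis dvd_imp_order_le order_node_poly)
next
  assume "p = 0 \<or> (\<forall>z. count_list ys z \<le> order z p)"
  then show "node_poly ys dvd p"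
  proof (induction ys arbitrary: p)
    case (Cons y ys)
    show ?case
    proof (cases "p = 0")
      case False
      with Cons.prems have ord: "\<And>z. count_list (y # ys) z \<le> order z p" by blast
      from ord[of y] have "order y p \<noteq> 0" by auto
      then obtain q where q: "p = [:- y, 1:] * q"
        by (metis order_root poly_eq_0_iff_dvd dvdE)
      with False have "[:- y, 1:] * q \<noteq> 0" by blast
      then have "order z p = (if y = z then 1 else 0) + order z q" for z
        using order_mult[of "[:- y, 1:]" q z] unfolding q order_linear by blast
      then have "count_list ys z \<le> order z q" for z
        using ord[of z] by (auto split: if_splits)
      then have "node_poly ys dvd q" using Cons.IH by blast
      then show ?thesis unfolding q node_poly_Cons by (rule mult_dvd_mono[OF dvd_refl])
    qed simp
  qed simp
qed

text \<open>Applied to a difference, this turns equality of Hermite data at \<open>ys\<close> into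
  congruence modulo \<open>node_poly ys\<close>.\<close>

lemma node_poly_dvd_iff:
  "node_poly ys dvd p \<longleftrightarrow> (\<forall>y k. k < count_list ys y \<longrightarrow> poly ((pderiv ^^ k) p) y = 0)"
proof -
  have "node_poly ys dvd p \<longleftrightarrow> (\<forall>y. [:- y, 1:] ^ count_list ys y dvd p)"
    by (auto simp: node_poly_dvd_iff_order order_divides)
  then show ?thesis by (simp add: linear_power_dvd_iff_higher_pderiv)
qed

section \<open>Existence and uniqueness of the Hermite interpolant\<close>

lemma higher_pderiv_diff: "(pderiv ^^ k) (p - q) = (pderiv ^^ k) p - (pderiv ^^ k) q"
  for p q :: "'a::idom poly"
  by (induction k) (simp_all add: pderiv_diff)

lemma hermite_interpolates_iff:
  "hermite_interpolates S f ys P \<longleftrightarrow> degree P < length ys \<and>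
     (\<forall>y k. k < count_list ys y \<longrightarrow> poly ((pderiv ^^ k) P) y = nderiv_on S f k y)"
  unfolding hermite_interpolates_def by (metis count_notin less_nat_zero_code)

text \<open>The difference of two interpolants is a multiple of \<open>node_poly ys\<close>, whose
  degree \<open>length ys\<close> is too large for a nonzero difference.\<close>

lemma hermite_interpolates_unique:
  assumes "hermite_interpolates S f ys P" and "hermite_interpolates S f ys P'"
  shows "P = P'"
proof (rule ccontr)
  assume "P \<noteq> P'"
  moreover have "node_poly ys dvd P - P'"
    using assms by (simp add: node_poly_dvd_iff higher_pderiv_diff hermite_interpolates_iff)
  ultimately have "length ys \<le> degree (P - P')"
    using dvd_imp_degree_le by fastforce
  moreover have "degree (P - P') < length ys"
    using assms by (auto simp: hermite_interpolates_def intro: degree_diff_less)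
  ultimately show False by simp
qed

text \<open>Newton's construction: adding a multiple of \<open>node_poly ys\<close> preserves all
  earlier conditions and can be tuned to meet the one new condition. The degree bound is put on
  coefficients so that the empty list is covered by the zero polynomial.\<close>

lemma hermite_interpolant_exists_aux:
  fixes ys :: "real list"
  shows "\<exists>P. (\<forall>i\<ge>length ys. coeff P i = 0) \<and>
       (\<forall>y k. k < count_list ys y \<longrightarrow> poly ((pderiv ^^ k) P) y = g k y)"
proof (induction ys)
  case Nil
  then show ?case by (intro exI[of _ 0]) simp
next
  case (Cons y ys)
  then obtain P where deg: "\<And>i. i \<ge> length ys \<Longrightarrow> coeff P i = 0"
    and P: "\<And>z k. k < count_list ys z \<Longrightarrow> poly ((pderiv ^^ k) P) z = g k z" by blast
  define m where "m = count_list ys y"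
  define w where "w = poly ((pderiv ^^ m) (node_poly ys)) y"
  define c where "c = (g m y - poly ((pderiv ^^ m) P) y) / w"
  define P' where "P' = P + smult c (node_poly ys)"
  have W0: "poly ((pderiv ^^ k) (node_poly ys)) z = 0" if "k < count_list ys z" for z k
    using node_poly_dvd_iff[of ys "node_poly ys"] that by simp
  \<comment> \<open>The root \<open>y\<close> of \<open>node_poly ys\<close> has order exactly
    \<open>m\<close>, so the derivative of order \<open>m\<close> is the first not to vanish
    there.\<close>
  have "w \<noteq> 0"
  proof
    assume "w = 0"
    then have "[:- y, 1:] ^ Suc m dvd node_poly ys"
      unfolding linear_power_dvd_iff_higher_pderiv
      using W0[of _ y] by (auto simp: w_def m_def less_Suc_eq)
    then show False by (simp add: order_divides order_node_poly m_def del: power_Suc)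
  qed
  have "poly ((pderiv ^^ k) P') z = g k z" if "k < count_list (y # ys) z" for z k
  proof (cases "k < count_list ys z")
    case True
    then show ?thesis by (simp add: P'_def higher_pderiv_add higher_pderiv_smult P W0)
  next
    case False
    with that have "z = y" "k = m" by (auto simp: m_def split: if_splits)
    with \<open>w \<noteq> 0\<close> show ?thesis
      by (simp add: P'_def higher_pderiv_add higher_pderiv_smult c_def flip: w_def)
  qed
  moreover have "coeff P' i = 0" if "i \<ge> length (y # ys)" for i
    using that by (simp add: P'_def deg coeff_eq_0)
  ultimately show ?case by blast
qed

lemma hermite_interpolant_exists:
  assumes "ys \<noteq> []"
  obtains P where "hermite_interpolates S f ys P"
proof -
  obtain P where deg: "\<forall>i\<ge>length ys. coeff P i = 0"
    and P: "\<forall>y k. k < count_list ys y \<longrightarrow> poly ((pderiv ^^ k) P) y = nderiv_on S f k y"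
    using hermite_interpolant_exists_aux[of ys "nderiv_on S f"] by blast
  have "degree P < length ys"
    using deg assms by (metis degree_0 leading_coeff_0_iff length_greater_0_conv not_le)
  with P that show thesis by (simp add: hermite_interpolates_iff)
qed

section \<open>Divided differences as values of a quotient\<close>

lemma divdiff_eq_coeff:
  assumes "hermite_interpolates S f ys P"
  shows "divdiff S f ys = coeff P (length ys - 1)"
proof -
  have "(THE P. hermite_interpolates S f ys P) = P"
    using assms hermite_interpolates_unique by blast
  then show ?thesis by (simp add: divdiff_def)
qed

text \<open>Write \<open>P = W * (P div W) + P mod W\<close>. Replacing the quotient by its value
  \<open>q\<close> at \<open>y\<close> changes \<open>P\<close> by a multiple of
  \<open>node_poly (y # ys)\<close>. The result \<open>H\<close> is therefore the interpolant at
  \<open>y # ys\<close>, and its coefficient of order \<open>length ys\<close> is \<open>q\<close>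
  because \<open>W\<close> is monic.\<close>

lemma divdiff_Cons_eq_poly_div:
  assumes P: "hermite_interpolates S f zs P"
    and sub: "\<And>z. count_list (y # ys) z \<le> count_list zs z"
  shows "divdiff S f (y # ys) = poly (P div node_poly ys) y"
proof -
  define W where "W = node_poly ys"
  define q where "q = poly (P div W) y"
  define H where "H = P mod W + smult q W"
  have degW: "degree W = length ys" and W0: "W \<noteq> 0" by (simp_all add: W_def)
  have mod0: "coeff (P mod W) i = 0" if "i \<ge> length ys" for i
    using degree_mod_less[OF W0, of P] that by (auto simp: degW coeff_eq_0)
  have "P - H = W * (P div W - [:q:])"
    using div_mult_mod_eq[of P W] by (simp add: H_def algebra_simps)
  moreover have "[:- y, 1:] dvd P div W - [:q:]"
    by (simp add: poly_eq_0_iff_dvd[symmetric] q_def)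
  ultimately have "node_poly (y # ys) dvd P - H"
    unfolding node_poly_Cons W_def[symmetric] by (metis mult.commute mult_dvd_mono dvd_refl)
  then have eq: "poly ((pderiv ^^ k) P) z = poly ((pderiv ^^ k) H) z"
    if "k < count_list (y # ys) z" for z k
    using that by (simp add: node_poly_dvd_iff higher_pderiv_diff)
  have "degree H \<le> length ys"
    by (rule degree_le) (auto simp: H_def mod0 coeff_eq_0 degW)
  moreover have "poly ((pderiv ^^ k) H) z = nderiv_on S f k z"
    if "k < count_list (y # ys) z" for z k
    using P order_less_le_trans[OF that sub] eq[OF that] by (simp add: hermite_interpolates_iff)
  ultimately have "hermite_interpolates S f (y # ys) H"
    unfolding hermite_interpolates_iff by simp
  then have "divdiff S f (y # ys) = coeff H (length ys)"
    using divdiff_eq_coeff by fastforce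
  also have "\<dots> = q" by (simp add: H_def mod0) (simp add: W_def)
  finally show ?thesis by (simp add: q_def W_def)
qed

section \<open>Rolle's theorem for zeros with multiplicity\<close>

text \<open>A zero of multiplicity \<open>m\<close> of \<open>h\<close> is kept \<open>m - 1\<close> times, and one new zero of the derivative
  is inserted between any two consecutive distinct zeros.\<close>

lemma Rolle_multiplicity_step:
  fixes h h' :: "real \<Rightarrow> real"
  assumes "\<And>y. y \<in> {a..b} \<Longrightarrow> (h has_real_derivative h' y) (at y within {a..b})"
    and "sorted (y # ys)" and "set (y # ys) \<subseteq> {a..b}" and "\<forall>z\<in>set (y # ys). h z = 0"
  shows "\<exists>zs. length zs = length ys \<and> set zs \<subseteq> {y..b} \<and>
           (\<forall>z\<in>set zs. z \<notin> set (y # ys) \<longrightarrow> h' z = 0) \<and>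
           (\<forall>z. count_list zs z \<le>
              (if z \<in> set (y # ys) then count_list (y # ys) z - 1 else 1))"
  using assms(2-)
proof (induction ys arbitrary: y)
  case (Cons u ys)
  then have "y \<le> u" and sorted: "sorted (u # ys)" by auto
  from Cons.IH[OF sorted] Cons.prems obtain zs where
    len: "length zs = length ys" and zs: "set zs \<subseteq> {u..b}"
    and zero: "\<And>z. z \<in> set zs \<Longrightarrow> z \<notin> set (u # ys) \<Longrightarrow> h' z = 0"
    and count: "\<And>z. count_list zs z \<le>
       (if z \<in> set (u # ys) then count_list (u # ys) z - 1 else 1)"
    by auto
  show ?case
  proof (cases "y = u")
    case True
    have "count_list (y # zs) z \<le>
        (if z \<in> set (y # u # ys) then count_list (y # u # ys) z - 1 else 1)" for z
      using count[of z] True by (auto split: if_splits)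
    then show ?thesis
      using len zs zero Cons.prems True by (intro exI[of _ "y # zs"]) auto
  next
    case False
    with \<open>y \<le> u\<close> have "y < u" by simp
    have yu: "{y..u} \<subseteq> {a..b}" using Cons.prems by auto
    have "continuous_on {a..b} h"
      using assms(1) by (meson DERIV_continuous_on)
    then have "continuous_on {y..u} h" using yu continuous_on_subset by blast
    moreover have der: "(h has_real_derivative h' z) (at z)" if "y < z" "z < u" for z
    proof -
      have "z \<in> interior {a..b}" and "z \<in> {a..b}" using that yu by auto
      then show ?thesis using assms(1) by (metis at_within_interior)
    qed
    then have "h differentiable at z" if "y < z" "z < u" for z
      using that real_differentiable_def by blast
    ultimately obtain \<xi> where \<xi>: "y < \<xi>" "\<xi> < u" "DERIV h \<xi> :> 0"
      using Rolle[OF \<open>y < u\<close>, of h] Cons.prems by auto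
    then have "h' \<xi> = 0" using der DERIV_unique by blast
    \<comment> \<open>The bound \<open>{u..b}\<close> on the zeros found so far separates them from
      \<xi>, which lies strictly below \<open>u\<close>; hence \<xi> is counted once.\<close>
    have above: "\<forall>z\<in>set (u # ys). u \<le> z" using sorted by auto
    have \<xi>_new: "\<xi> \<notin> set (y # u # ys)" "\<xi> \<notin> set zs" "\<xi> \<noteq> y" using \<xi> above zs by auto
    have y_new: "y \<notin> set (u # ys)" "y \<notin> set zs" using \<open>y < u\<close> above zs by auto
    have "count_list (\<xi> # zs) z \<le>
        (if z \<in> set (y # u # ys) then count_list (y # u # ys) z - 1 else 1)" for z
    proof -
      consider "z = \<xi>" | "z = y" | "z \<noteq> \<xi>" "z \<noteq> y" by blast
      then show ?thesis
      proof cases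
        case 1
        with \<xi>_new show ?thesis by simp
      next
        case 2
        with \<xi>_new y_new show ?thesis by simp
      next
        case 3
        with count[of z] show ?thesis by auto
      qed
    qed
    moreover have "h' z = 0" if "z \<in> set (\<xi> # zs)" "z \<notin> set (y # u # ys)" for z
      using that zero \<open>h' \<xi> = 0\<close> by auto
    moreover have "set (\<xi> # zs) \<subseteq> {y..b}"
      using zs \<xi> Cons.prems by auto
    ultimately show ?thesis
      using len by (intro exI[of _ "\<xi> # zs"]) auto
  qed
qed simp

text \<open>The function \<open>h k\<close> acts as the derivative of order \<open>k\<close> of
  \<open>h 0\<close>. Each pass from \<open>h 0\<close> to \<open>h 1\<close> loses exactly one
  zero, counted with multiplicity, so one of the initial \<open>N + 1\<close> survives.\<close>

lemma Rolle_multiplicity: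
  fixes h :: "nat \<Rightarrow> real \<Rightarrow> real"
  assumes "\<And>k y. k < N \<Longrightarrow> y \<in> {a..b} \<Longrightarrow>
             (h k has_real_derivative h (Suc k) y) (at y within {a..b})"
    and "length ys = Suc N" and "set ys \<subseteq> {a..b}"
    and "\<And>y k. k < count_list ys y \<Longrightarrow> h k y = 0"
  shows "\<exists>\<xi>\<in>{a..b}. h N \<xi> = 0"
  using assms
proof (induction N arbitrary: h ys)
  case 0
  then obtain y where "ys = [y]" by (auto simp: length_Suc_conv)
  with 0(3) 0(4)[of 0 y] show ?case by auto
next
  case (Suc N)
  obtain u us where us: "sort ys = u # us"
    using Suc.prems(2) by (metis length_0_conv length_sort list.exhaust nat.distinct(1))
  have count: "count_list (u # us) z = count_list ys z" for z
    by (metis us count_mset mset_sort)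
  have set: "set (u # us) = set ys" by (metis us set_sort)
  have len: "length us = Suc N"
    using Suc.prems(2) by (metis us length_sort length_Cons Suc_inject)
  have der: "(h 0 has_real_derivative h 1 y) (at y within {a..b})" if "y \<in> {a..b}" for y
    using Suc.prems(1)[of 0 y] that by simp
  have "sorted (u # us)" by (metis us sorted_sort)
  moreover have "set (u # us) \<subseteq> {a..b}" using Suc.prems(3) set by simp
  moreover have "\<forall>z\<in>set (u # us). h 0 z = 0"
    using Suc.prems(4) unfolding set by (metis count_list_0_iff neq0_conv)
  ultimately have "\<exists>zs. length zs = length us \<and> set zs \<subseteq> {u..b} \<and>
           (\<forall>z\<in>set zs. z \<notin> set (u # us) \<longrightarrow> h 1 z = 0) \<and>
           (\<forall>z. count_list zs z \<le>
              (if z \<in> set (u # us) then count_list (u # us) z - 1 else 1))"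
    by (intro Rolle_multiplicity_step[of a b "h 0" "h 1"] der)
  then obtain zs where zs: "length zs = length us" "set zs \<subseteq> {u..b}"
    and zero: "\<forall>z\<in>set zs. z \<notin> set (u # us) \<longrightarrow> h 1 z = 0"
    and le: "\<forall>z. count_list zs z \<le>
              (if z \<in> set (u # us) then count_list (u # us) z - 1 else 1)"
    by (elim exE conjE)
  \<comment> \<open>An old zero has lost one from its multiplicity, which pays for the shift from
    \<open>k\<close> to \<open>Suc k\<close>. A new zero is simple, so only \<open>k = 0\<close>
    arises.\<close>
  have "h (Suc k) z = 0" if k: "k < count_list zs z" for z k
  proof (cases "z \<in> set ys")
    case True
    then have "Suc k < count_list ys z"
      using k spec[OF le, of z] unfolding count set by simp
    then show ?thesis by (rule Suc.prems(4))
  next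
    case False
    then have "k < 1" using k spec[OF le, of z] unfolding set by simp
    moreover have "z \<in> set zs" using k by (metis count_notin not_less_zero)
    ultimately show ?thesis using zero False set by auto
  qed
  moreover have "set zs \<subseteq> {a..b}" using zs(2) Suc.prems(3) set by force
  ultimately show ?case
    using Suc.IH[of "\<lambda>k. h (Suc k)" zs] Suc.prems(1) zs(1) len by auto
qed

section \<open>The leading coefficient of the interpolant as a derivative of
  \<open>f\<close>\<close>

lemma Ck_on_imp_nderiv_on_DERIV:
  assumes "Ck_on m S f" and "k < m" and "y \<in> S"
  shows "(nderiv_on S f k has_real_derivative nderiv_on S f (Suc k) y) (at y within S)"
proof -
  have "nderiv_on S f k differentiable (at y within S)"
    using assms by (auto simp: Ck_on_def differentiable_on_def)
  then show ?thesis
    by (simp add: vector_derivative_works has_real_derivative_iff_has_vector_derivative)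
qed

text \<open>Rolle applies to \<open>f - P\<close>, which has the \<open>m + 1\<close> zeros
  \<open>ys\<close>; since \<open>degree P \<le> m\<close>, the derivative of \<open>P\<close> of
  order \<open>m\<close> is the constant \<open>fact m * coeff P m\<close>.\<close>

lemma hermite_interpolant_lead_coeff:
  assumes "Ck_on m S f" and P: "hermite_interpolates S f ys P" and "length ys = Suc m"
    and "set ys \<subseteq> {a..b}" and "{a..b} \<subseteq> S"
  shows "\<exists>\<xi>\<in>{a..b}. nderiv_on S f m \<xi> = fact m * coeff P m"
proof -
  define h where "h k y = nderiv_on S f k y - poly ((pderiv ^^ k) P) y" for k y
  have "(h k has_real_derivative h (Suc k) y) (at y within {a..b})"
    if "k < m" "y \<in> {a..b}" for k y
  proof -
    have "(nderiv_on S f k has_real_derivative nderiv_on S f (Suc k) y) (at y within {a..b})"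
      using that assms Ck_on_imp_nderiv_on_DERIV DERIV_subset by blast
    moreover have "(poly ((pderiv ^^ k) P) has_real_derivative poly ((pderiv ^^ Suc k) P) y)
        (at y within {a..b})"
      using poly_DERIV DERIV_subset by fastforce
    ultimately show ?thesis unfolding h_def by (rule DERIV_diff)
  qed
  moreover have "h k y = 0" if "k < count_list ys y" for k y
    using P that by (simp add: h_def hermite_interpolates_iff)
  ultimately obtain \<xi> where \<xi>: "\<xi> \<in> {a..b}" "h m \<xi> = 0"
    using Rolle_multiplicity[of m a b h ys] assms by blast
  have "degree P \<le> m"
    using P assms(3) by (simp add: hermite_interpolates_def)
  then have "degree ((pderiv ^^ m) P) = 0" by (simp add: degree_higher_pderiv)
  then obtain c where c: "(pderiv ^^ m) P = [:c:]" by (rule degree_eq_zeroE)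
  have "c = coeff ((pderiv ^^ m) P) 0" by (simp add: c)
  also have "\<dots> = fact m * coeff P m"
    by (simp add: coeff_higher_pderiv pochhammer_fact)
  finally show ?thesis using \<xi> c by (auto simp: h_def)
qed

section \<open>Neville and Aitken iterates\<close>

text \<open>The weights \<open>(b - t) / (b - a)\<close> and \<open>(t - a) / (b - a)\<close> sum to
  one, so agreement with \<open>g\<close> on \<open>I\<close> persists. At \<open>a\<close> only
  \<open>A\<close> counts, at \<open>b\<close> only \<open>B\<close>. Both recursions are
  instances.\<close>

lemma interpolation_step:
  fixes a b :: real
  assumes "degree A \<le> m" and "degree B \<le> m" and "a \<noteq> b"
    and "\<forall>t\<in>insert a I. poly A t = g t" and "\<forall>t\<in>insert b I. poly B t = g t"
  shows "\<exists>L. degree L \<le> Suc m \<and> (\<forall>t\<in>insert a (insert b I). poly L t = g t) \<and>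
    (\<forall>x. 1 / (b - a) *
      det (vector [vector [poly A x, a - x], vector [poly B x, b - x]] :: real^2^2) = poly L x)"
proof -
  define L where "L = smult (1 / (b - a)) (A * [:b, - 1:] - B * [:a, - 1:])"
  have "degree (A * [:b, - 1:]) \<le> Suc m" "degree (B * [:a, - 1:]) \<le> Suc m"
    using degree_mult_le[of A "[:b, - 1:]"] degree_mult_le[of B "[:a, - 1:]"] assms(1,2)
    by auto
  then have "degree L \<le> Suc m"
    unfolding L_def by (meson degree_diff_le degree_smult_le order_trans)
  moreover have L: "poly L x = 1 / (b - a) * (poly A x * (b - x) - poly B x * (a - x))" for x
    by (simp add: L_def algebra_simps)
  have "poly L t = g t" if "t \<in> insert a (insert b I)" for t
  proof -
    have "poly A t * (b - t) - poly B t * (a - t) = (b - a) * g t"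
      using that assms(4,5) by (auto simp: algebra_simps)
    with \<open>a \<noteq> b\<close> show ?thesis by (simp add: L)
  qed
  moreover have "1 / (b - a) *
      det (vector [vector [poly A x, a - x], vector [poly B x, b - x]] :: real^2^2) = poly L x" for x
    by (simp add: L det_2 vector_2 algebra_simps)
  ultimately show ?thesis by blast
qed

text \<open>The two entries of the determinant share the nodes with indices \<open>j + 1\<close> to
  \<open>j + i\<close>; these form the set \<open>I\<close> of \<open>interpolation_step\<close>.
  The polynomial \<open>L\<close> is chosen before \<open>x\<close>.\<close>

lemma neville_eq_poly:
  assumes "inj_on X {j..i + j}"
  shows "\<exists>L. degree L \<le> i \<and> (\<forall>t\<in>X ` {j..i + j}. poly L t = divdiff_at S f X r t) \<and>
    (\<forall>x. neville S f X r x i j = poly L x)"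
  using assms
proof (induction i arbitrary: j)
  case 0
  show ?case by (intro exI[of _ "[:divdiff_at S f X r (X j):]"]) simp
next
  case (Suc i)
  let ?I = "X ` {Suc j..i + j}"
  have split: "insert (X j) ?I = X ` {j..i + j}"
    "insert (X (Suc i + j)) ?I = X ` {Suc j..i + Suc j}"
    "insert (X j) (insert (X (Suc i + j)) ?I) = X ` {j..Suc i + j}"
    unfolding image_insert[symmetric] by (rule arg_cong[where f = "image X"]; auto)+
  have "inj_on X {j..i + j}" "inj_on X {Suc j..i + Suc j}"
    using Suc.prems by (auto intro: inj_on_subset)
  from Suc.IH[OF this(1)] Suc.IH[OF this(2)] obtain A B where
    A: "degree A \<le> i" "\<forall>t\<in>X ` {j..i + j}. poly A t = divdiff_at S f X r t"
       "\<And>x. neville S f X r x i j = poly A x" and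
    B: "degree B \<le> i" "\<forall>t\<in>X ` {Suc j..i + Suc j}. poly B t = divdiff_at S f X r t"
       "\<And>x. neville S f X r x i (Suc j) = poly B x"
    by blast
  have "X j \<noteq> X (Suc i + j)"
    using Suc.prems by (auto dest: inj_onD)
  from interpolation_step[OF A(1) B(1) this, of ?I "divdiff_at S f X r",
      unfolded split(3), unfolded split(1,2), OF A(2) B(2)]
  show ?case by (simp only: neville.simps Suc_eq_plus1[symmetric] A(3) B(3))
qed

text \<open>Here the shared nodes have indices \<open>r\<close> to \<open>r + k - 1\<close>, and the
  two extra nodes are \<open>X (r + k)\<close> and \<open>X j\<close>.\<close>

lemma aitken_eq_poly:
  assumes "inj_on X (insert j {r..<r + k})" and "r + k \<le> j"
  shows "\<exists>L. degree L \<le> k \<and> (\<forall>t\<in>X ` insert j {r..<r + k}. poly L t = divdiff_at S f X r t) \<and>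
    (\<forall>x. aitken S f X r x k j = poly L x)"
  using assms
proof (induction k arbitrary: j)
  case 0
  show ?case by (intro exI[of _ "[:divdiff_at S f X r (X j):]"]) simp
next
  case (Suc k)
  let ?I = "X ` {r..<r + k}"
  have split: "insert (X (r + k)) (insert (X j) ?I) = X ` insert j {r..<r + Suc k}"
    by (auto simp: less_Suc_eq)
  have "inj_on X (insert (r + k) {r..<r + k})" "inj_on X (insert j {r..<r + k})"
    by (rule inj_on_subset[OF Suc.prems(1)]; auto)+
  from Suc.IH[OF this(1)] Suc.IH[OF this(2)] Suc.prems(2) obtain A B where
    A: "degree A \<le> k" "\<forall>t\<in>X ` insert (r + k) {r..<r + k}. poly A t = divdiff_at S f X r t"
       "\<And>x. aitken S f X r x k (r + k) = poly A x" and
    B: "degree B \<le> k" "\<forall>t\<in>X ` insert j {r..<r + k}. poly B t = divdiff_at S f X r t"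
       "\<And>x. aitken S f X r x k j = poly B x"
    by auto
  have "X (r + k) \<noteq> X j"
    using inj_onD[OF Suc.prems(1), of "r + k" j] Suc.prems(2) by auto
  from interpolation_step[OF A(1) B(1) this, of ?I "divdiff_at S f X r", unfolded split]
    A(2) B(2)
  show ?case by (simp only: aitken.simps A(3) B(3) image_insert simp_thms)
qed

text \<open>The error \<open>E\<close> vanishes at all of \<open>zs\<close>, so if nonzero it has
  degree at least \<open>length zs\<close>. Multiplying by \<open>W\<close> brings back
  \<open>P\<close> and shows that the degree is smaller.\<close>

lemma quotient_interpolation_error:
  assumes "degree P \<le> length ys + length zs" and "distinct zs"
    and "degree L < length zs" and "\<And>z. z \<in> set zs \<Longrightarrow> poly (P div node_poly ys) z = poly L z"
  shows "P div node_poly ys = L + smult (coeff P (length ys + length zs)) (node_poly zs)"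
proof -
  define W V c where "W = node_poly ys" and "V = node_poly zs"
    and "c = coeff P (length ys + length zs)"
  define E where "E = P div W - (L + smult c V)"
  have W0: "W \<noteq> 0" and degs: "degree W = length ys" "degree V = length zs"
    by (simp_all add: W_def V_def)
  have "E = 0"
  proof (rule ccontr)
    assume "E \<noteq> 0"
    have "poly V z = 0" if "z \<in> set zs" for z
      using that by (auto simp: V_def poly_node_poly prod_list_zero_iff)
    then have "poly E z = poly 0 z" if "z \<in> set zs" for z
      using that assms(4) by (simp add: E_def W_def)
    with poly_eqI_degree[of "set zs" E 0] \<open>E \<noteq> 0\<close> have deg_E: "length zs \<le> degree E"
      using \<open>distinct zs\<close> assms(3) by (fastforce simp: distinct_card)
    have "P = W * (P div W) + P mod W" by simp
    then have WE: "W * E = P - P mod W - W * L - smult c (node_poly (ys @ zs))"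
      by (simp add: E_def W_def V_def node_poly_append algebra_simps)
    have "coeff (W * E) i = 0" if "i \<ge> length ys + length zs" for i
    proof -
      have "coeff (P mod W) i = 0"
        using degree_mod_less[OF W0, of P] that by (auto simp: degs coeff_eq_0)
      moreover have "coeff (W * L) i = 0"
        using that assms(3) degree_mult_le[of W L] by (intro coeff_eq_0) (simp add: degs)
      \<comment> \<open>\<open>W * V\<close> is monic of degree
        \<open>length ys + length zs\<close>, so \<open>c\<close> is just what cancels the top
        coefficient of \<open>P\<close>.\<close>
      moreover have "coeff P i = c * coeff (node_poly (ys @ zs)) i"
      proof (cases "i = length ys + length zs")
        case True
        then show ?thesis using coeff_node_poly_length[of "ys @ zs"] by (simp add: c_def)
      next
        case False
        with that assms(1) show ?thesis by (simp add: coeff_eq_0)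
      qed
      ultimately show ?thesis by (simp add: WE)
    qed
    moreover have "coeff (W * E) (degree W + degree E) \<noteq> 0"
      using W0 \<open>E \<noteq> 0\<close> by (simp add: coeff_mult_degree_sum)
    ultimately show False using deg_E degs by fastforce
  qed
  then show ?thesis by (simp add: E_def W_def V_def c_def)
qed

theorem theorem2p1:
  fixes r n :: nat and p q x :: real and X :: "nat \<Rightarrow> real" and f :: "real \<Rightarrow> real"
  assumes "r \<le> n"
    and "\<forall>i\<le>n. X i \<in> {p..q}"
    and "inj_on X {r..n}"
    and "x \<in> {p..q}"
    and "Ck_on (n + 1) {p..q} f"
  shows "\<exists>\<xi> \<in> {Min (insert x (X ` {0..n})) .. Max (insert x (X ` {0..n}))}.
      divdiff_at {p..q} f X r x =
        neville {p..q} f X r x (n - r) r +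
        nderiv_on {p..q} f (n + 1) \<xi> / fact (n + 1) * (\<Prod>i=r..n. x - X i) \<and>
      divdiff_at {p..q} f X r x =
        aitken {p..q} f X r x (n - r) n +
        nderiv_on {p..q} f (n + 1) \<xi> / fact (n + 1) * (\<Prod>i=r..n. x - X i)"
proof -
  let ?S = "{p..q}"
  define ys where "ys = map X [0..<r]"
  define zs where "zs = map X [r..<Suc n]"
  define nodes where "nodes = x # ys @ zs"
  define a b where "a = Min (insert x (X ` {0..n}))" and "b = Max (insert x (X ` {0..n}))"
  obtain P where P: "hermite_interpolates ?S f nodes P"
    by (rule hermite_interpolant_exists[of nodes]) (simp add: nodes_def)
  define Q where "Q = P div node_poly ys"
  have len: "length ys = r" "length zs = Suc n - r" "length ys + length zs = n + 1"
    "length nodes = Suc (n + 1)"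
    using \<open>r \<le> n\<close> by (simp_all add: ys_def zs_def nodes_def)
  have set_zs: "set zs = X ` {r..n}" by (auto simp: zs_def less_Suc_eq_le)
  have dist: "distinct zs"
    using assms(3) by (simp add: zs_def distinct_map atLeastLessThanSuc_atLeastAtMost del: upt_Suc)
  have dd: "divdiff_at ?S f X r y = poly Q y" if "y = x \<or> y \<in> X ` {r..n}" for y
  proof -
    have "y = x \<or> y \<in> set zs" using that set_zs by blast
    \<comment> \<open>Besides the copies of \<open>y\<close> in \<open>ys\<close>,
      \<open>nodes\<close> has a further one from \<open>x\<close> or from \<open>zs\<close>, even
      if values coincide.\<close>
    then have "count_list (y # ys) z \<le> count_list nodes z" for z
      by (auto simp: nodes_def Suc_le_eq) (metis count_list_0_iff neq0_conv)
    from divdiff_Cons_eq_poly_div[OF P this] show ?thesis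
      by (simp add: divdiff_at_def ys_def Q_def)
  qed
  define A where "A = insert x (X ` {0..n})"
  have A: "finite A" "A \<noteq> {}" "A \<subseteq> ?S" using assms(2,4) by (auto simp: A_def)
  have "set nodes \<subseteq> A"
    using \<open>r \<le> n\<close> by (auto simp: nodes_def ys_def set_zs A_def)
  also have "A \<subseteq> {a..b}"
    using A(1) by (simp add: a_def b_def subset_iff flip: A_def)
  finally have "set nodes \<subseteq> {a..b}" .
  moreover have "{a..b} \<subseteq> ?S"
    using Min_in[OF A(1,2)] Max_in[OF A(1,2)] A(3) by (auto simp: a_def b_def simp flip: A_def)
  ultimately obtain \<xi> where \<xi>: "\<xi> \<in> {a..b}"
    "nderiv_on ?S f (n + 1) \<xi> = fact (n + 1) * coeff P (n + 1)"
    using hermite_interpolant_lead_coeff[OF assms(5) P len(4)] by blast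
  have deg_P: "degree P \<le> n + 1"
    using P len(4) by (simp add: hermite_interpolates_def)
  have "poly (node_poly zs) x = (\<Prod>i=r..n. x - X i)"
    unfolding poly_node_poly zs_def
    by (simp add: prod.distinct_set_conv_list[symmetric] atLeastLessThanSuc_atLeastAtMost o_def
        del: upt_Suc)
  \<comment> \<open>The point \<xi> comes from \<open>P\<close> alone and \<open>L\<close> stays
    arbitrary, so the same \<xi> serves both iterates.\<close>
  then have *: "divdiff_at ?S f X r x =
      poly L x + nderiv_on ?S f (n + 1) \<xi> / fact (n + 1) * (\<Prod>i=r..n. x - X i)"
    if "degree L \<le> n - r" "\<forall>t\<in>X ` {r..n}. poly L t = divdiff_at ?S f X r t" for L
    using quotient_interpolation_error[of P ys zs L] deg_P dist that \<open>r \<le> n\<close> dd \<xi>(2)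
    by (simp add: len set_zs Q_def)
  have split: "insert n {r..<r + (n - r)} = {r..n}" using assms(1) by auto
  have "inj_on X {r..(n - r) + r}" using assms(1,3) by simp
  from neville_eq_poly[OF this, of ?S f r] * assms(1)
  have "divdiff_at ?S f X r x = neville ?S f X r x (n - r) r +
      nderiv_on ?S f (n + 1) \<xi> / fact (n + 1) * (\<Prod>i=r..n. x - X i)" by auto
  moreover from aitken_eq_poly[of X n r "n - r" ?S f, unfolded split, OF assms(3)] * assms(1)
  have "divdiff_at ?S f X r x = aitken ?S f X r x (n - r) n +
      nderiv_on ?S f (n + 1) \<xi> / fact (n + 1) * (\<Prod>i=r..n. x - X i)"
    by auto
  ultimately show ?thesis using \<xi>(1) unfolding a_def b_def by blast
qed

end
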